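(* Let $G$ be a connected, non-complete finite simple graph, and let $F$ be the subgraph of $G$ consisting of all forced edges of $G$ (together with their endpoints). Then $G=H^2$ for some graph $H$ with girth at least seven if and only if all of the following conditions hold: (i) every vertex in $V_G\setminus V_F$ belongs to exactly one maximal clique in $G$; (ii) every edge in $F$ belongs to exactly two distinct maximal cliques in $G$; (iii) every two non-disjoint edges in $F$ belong to a common maximal clique in $G$; (iv) for each maximal clique $Q$ of $G$, the induced subgraph $F[Q\cap V_F]$ is a star; (v) $F$ is connected and has girth at least seven.
   Context: All graphs are finite, undirected and simple. For a graph $H$, $H^2$ is the graph on the same vertex set in which two distinct vertices are adjacent iff their distance in $H$ is at most $2$. The girth of a graph is the length of a shortest cycle ($\infty$ if acyclic). A maximal clique is a set of pairwise adjacent vertices not properly contained in another such set. An edge of $G$ is called forced if it is contained in at least two distinct maximal cliques of $G$; $V_F$ denotes the vertex set of $F$. A star is a graph with at least two vertices that has a vertex adjacent to all other vertices (a center vertex), the other vertices being pairwise non-adjacent. $F[X]$ denotes the subgraph of $F$ induced by $X$. *)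

theory Defs
  imports Main "HOL-Library.Extended_Nat"
begin

record 'a ugraph =
  verts :: "'a set"
  edges :: "'a set set"

definition simple_graph :: "'a ugraph \<Rightarrow> bool" where
  "simple_graph G \<longleftrightarrow>
     finite (verts G) \<and> (\<forall>e\<in>edges G. e \<subseteq> verts G \<and> card e = 2)"

definition adj :: "'a ugraph \<Rightarrow> 'a \<Rightarrow> 'a \<Rightarrow> bool" where
  "adj G u v \<longleftrightarrow> {u, v} \<in> edges G"

text \<open>A walk is given by its nonempty list of vertices, so its number of edges is
  one less than the length of the list.\<close>

definition walk :: "'a ugraph \<Rightarrow> 'a list \<Rightarrow> bool" where
  "walk G xs \<longleftrightarrow> xs \<noteq> [] \<and> set xs \<subseteq> verts G \<and> successively (adj G) xs"

definition walks_between :: "'a ugraph \<Rightarrow> 'a \<Rightarrow> 'a \<Rightarrow> 'a list set" where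
  "walks_between G u v = {xs. walk G xs \<and> hd xs = u \<and> last xs = v}"

text \<open>The infimum of the empty set is \<open>\<infinity>\<close> in \<^typ>\<open>enat\<close>; this is the distance between
  vertices of different components, and the girth of an acyclic graph.\<close>

definition gdist :: "'a ugraph \<Rightarrow> 'a \<Rightarrow> 'a \<Rightarrow> enat" where
  "gdist G u v = (INF xs\<in>walks_between G u v. enat (length xs - 1))"

definition connected_graph :: "'a ugraph \<Rightarrow> bool" where
  "connected_graph G \<longleftrightarrow>
     verts G \<noteq> {} \<and> (\<forall>u\<in>verts G. \<forall>v\<in>verts G. walks_between G u v \<noteq> {})"

definition complete_graph :: "'a ugraph \<Rightarrow> bool" where
  "complete_graph G \<longleftrightarrow> (\<forall>u\<in>verts G. \<forall>v\<in>verts G. u \<noteq> v \<longrightarrow> adj G u v)"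

text \<open>A cycle is listed without repeating its first vertex at the end, so its length is
  the length of the list.\<close>

definition cycle :: "'a ugraph \<Rightarrow> 'a list \<Rightarrow> bool" where
  "cycle G xs \<longleftrightarrow> 3 \<le> length xs \<and> distinct xs \<and> walk G xs \<and> adj G (last xs) (hd xs)"

definition girth :: "'a ugraph \<Rightarrow> enat" where
  "girth G = (INF xs\<in>{xs. cycle G xs}. enat (length xs))"

definition square :: "'a ugraph \<Rightarrow> 'a ugraph" where
  "square H = \<lparr> verts = verts H,
     edges = {{u, v} | u v. u \<in> verts H \<and> v \<in> verts H \<and> u \<noteq> v \<and> gdist H u v \<le> 2} \<rparr>"

definition clique :: "'a ugraph \<Rightarrow> 'a set \<Rightarrow> bool" where
  "clique G K \<longleftrightarrow> K \<subseteq> verts G \<and> (\<forall>u\<in>K. \<forall>v\<in>K. u \<noteq> v \<longrightarrow> adj G u v)"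

definition maximal_clique :: "'a ugraph \<Rightarrow> 'a set \<Rightarrow> bool" where
  "maximal_clique G Q \<longleftrightarrow> clique G Q \<and> \<not> (\<exists>K. clique G K \<and> Q \<subset> K)"

definition forced_edge :: "'a ugraph \<Rightarrow> 'a set \<Rightarrow> bool" where
  "forced_edge G e \<longleftrightarrow> e \<in> edges G \<and>
     (\<exists>Q1 Q2. maximal_clique G Q1 \<and> maximal_clique G Q2 \<and> Q1 \<noteq> Q2 \<and> e \<subseteq> Q1 \<and> e \<subseteq> Q2)"

definition forced_subgraph :: "'a ugraph \<Rightarrow> 'a ugraph" where
  "forced_subgraph G = \<lparr> verts = \<Union>{e. forced_edge G e}, edges = {e. forced_edge G e} \<rparr>"

definition induced_subgraph :: "'a ugraph \<Rightarrow> 'a set \<Rightarrow> 'a ugraph" where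
  "induced_subgraph G X = \<lparr> verts = verts G \<inter> X, edges = {e \<in> edges G. e \<subseteq> X} \<rparr>"

definition star :: "'a ugraph \<Rightarrow> bool" where
  "star S \<longleftrightarrow> 2 \<le> card (verts S) \<and>
     (\<exists>c\<in>verts S. (\<forall>v\<in>verts S - {c}. adj S c v) \<and>
        (\<forall>u\<in>verts S - {c}. \<forall>v\<in>verts S - {c}. u \<noteq> v \<longrightarrow> \<not> adj S u v))"

end

theory Submission
  imports Defs
begin

text \<open>If \<open>H\<close> has girth at least seven then every clique of its square lies in a closed neighbourhood,
  so the maximal cliques of \<open>H\<^sup>2\<close> are the closed neighbourhoods \<open>N[v]\<close> of the inner
  vertices (degree at least two). Two of them share an edge only if their centres are adjacent, so
  that \<open>F\<close> is \<open>H\<close> without its leaves. Conversely, (i)--(v) allow one to index the maximal cliques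
  bijectively by \<open>V\<^sub>F\<close> so that the clique of \<open>v\<close> meets \<open>V\<^sub>F\<close> exactly in the closed neighbourhood
  of \<open>v\<close> in \<open>F\<close>; attaching each vertex outside \<open>F\<close> as a leaf to the index of its unique maximal
  clique yields the square root.\<close>

section \<open>Adjacency, connectedness, girth and squares\<close>

lemma adj_commute: "adj G u v \<longleftrightarrow> adj G v u"
  by (simp add: adj_def insert_commute)

lemma adj_irrefl: "simple_graph G \<Longrightarrow> \<not> adj G u u"
  by (auto simp: simple_graph_def adj_def)

lemma adj_verts: "simple_graph G \<Longrightarrow> adj G u v \<Longrightarrow> u \<in> verts G \<and> v \<in> verts G"
  by (auto simp: simple_graph_def adj_def)

lemma edgeE:
  assumes "simple_graph G" "e \<in> edges G"
  obtains u v where "e = {u, v}" "u \<noteq> v" "adj G u v"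
  using assms by (force simp: simple_graph_def adj_def card_2_iff)

lemma walk_imp_rtranclp: "walk G xs \<Longrightarrow> (adj G)\<^sup>*\<^sup>* (hd xs) (last xs)"
proof (induction xs)
  case Nil
  then show ?case by (simp add: walk_def)
next
  case (Cons x xs)
  show ?case
  proof (cases xs)
    case Nil
    then show ?thesis by simp
  next
    case (Cons y ys)
    with Cons.prems have "walk G xs" "adj G x y"
      by (auto simp: walk_def)
    with Cons.IH Cons show ?thesis
      by (auto intro: converse_rtranclp_into_rtranclp)
  qed
qed

lemma rtranclp_imp_walk:
  assumes "simple_graph G" "(adj G)\<^sup>*\<^sup>* u v" "v \<in> verts G"
  shows "walks_between G u v \<noteq> {}"
  using assms(2)
proof (induction rule: converse_rtranclp_induct)
  case base
  have "[v] \<in> walks_between G v v"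
    using assms(3) by (simp add: walks_between_def walk_def)
  then show ?case by blast
next
  case (step x y)
  then obtain xs where xs: "walk G xs" "hd xs = y" "last xs = v"
    by (auto simp: walks_between_def)
  have "x # xs \<in> walks_between G x v"
    using xs step.hyps adj_verts[OF assms(1) step.hyps(1)]
    by (auto simp: walks_between_def walk_def successively_Cons)
  then show ?case by blast
qed

text \<open>Replaces walks by the reflexive transitive closure, so that connectedness arguments
  become rule inductions.\<close>

lemma connected_graph_iff:
  assumes "simple_graph G"
  shows "connected_graph G \<longleftrightarrow>
    verts G \<noteq> {} \<and> (\<forall>u\<in>verts G. \<forall>v\<in>verts G. (adj G)\<^sup>*\<^sup>* u v)"
proof -
  have "(adj G)\<^sup>*\<^sup>* u v" if "walks_between G u v \<noteq> {}" for u v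
    using that walk_imp_rtranclp by (fastforce simp: walks_between_def)
  then show ?thesis
    using rtranclp_imp_walk[OF assms] unfolding connected_graph_def by blast
qed

text \<open>Serves to show that a nonempty vertex set with no edge leaving it exhausts a connected
  graph.\<close>

lemma rtranclp_closed:
  assumes "R\<^sup>*\<^sup>* x y" "x \<in> S" "\<And>a b. a \<in> S \<Longrightarrow> R a b \<Longrightarrow> b \<in> S"
  shows "y \<in> S"
  using assms(1) by (induction) (use assms(2,3) in auto)

section \<open>Girth at least seven\<close>

lemma girth_ge_iff: "enat n \<le> girth G \<longleftrightarrow> (\<forall>xs. cycle G xs \<longrightarrow> n \<le> length xs)"
  by (simp add: girth_def le_INF_iff)

text \<open>Cycles of length 3 to 6 are excluded on named vertices, so that later arguments only
  have to exhibit the vertices. In a simple graph the vertices of a triangle are automatically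
  distinct; from length 4 on distinctness must be required, since closed walks such as a, b, a, b
  would otherwise count.\<close>

definition no_short_cycle :: "'a ugraph \<Rightarrow> bool" where
  "no_short_cycle G \<longleftrightarrow>
     (\<forall>a b c. adj G a b \<and> adj G b c \<longrightarrow> \<not> adj G c a) \<and>
     (\<forall>a b c d. distinct [a, b, c, d] \<and> adj G a b \<and> adj G b c \<and> adj G c d \<longrightarrow> \<not> adj G d a) \<and>
     (\<forall>a b c d e. distinct [a, b, c, d, e] \<and> adj G a b \<and> adj G b c \<and> adj G c d \<and> adj G d e
        \<longrightarrow> \<not> adj G e a) \<and>
     (\<forall>a b c d e f. distinct [a, b, c, d, e, f] \<and> adj G a b \<and> adj G b c \<and> adj G c d \<and> adj G d e
        \<and> adj G e f \<longrightarrow> \<not> adj G f a)"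

lemma no_short_cycleD:
  assumes "no_short_cycle G"
  shows "adj G a b \<Longrightarrow> adj G b c \<Longrightarrow> \<not> adj G c a"
    and "distinct [a, b, c, d] \<Longrightarrow> adj G a b \<Longrightarrow> adj G b c \<Longrightarrow> adj G c d \<Longrightarrow> \<not> adj G d a"
    and "distinct [a, b, c, d, e] \<Longrightarrow> adj G a b \<Longrightarrow> adj G b c \<Longrightarrow> adj G c d \<Longrightarrow> adj G d e
      \<Longrightarrow> \<not> adj G e a"
    and "distinct [a, b, c, d, e, f] \<Longrightarrow> adj G a b \<Longrightarrow> adj G b c \<Longrightarrow> adj G c d \<Longrightarrow> adj G d e
      \<Longrightarrow> adj G e f \<Longrightarrow> \<not> adj G f a"
  using assms unfolding no_short_cycle_def by blast+

lemma girth_ge_7_iff: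
  assumes G: "simple_graph G"
  shows "7 \<le> girth G \<longleftrightarrow> no_short_cycle G"
proof
  assume "7 \<le> girth G"
  then have "enat 7 \<le> girth G" by (simp add: numeral_eq_enat)
  then have *: "7 \<le> length xs" if "cycle G xs" for xs
    using that girth_ge_iff by blast
  have tri: "\<not> adj G c a" if "adj G a b" "adj G b c" for a b c
  proof
    assume "adj G c a"
    with that have "cycle G [a, b, c]"
      using adj_irrefl[OF G] adj_verts[OF G] by (auto simp: cycle_def walk_def)
    from *[OF this] show False by simp
  qed
  show "no_short_cycle G"
    unfolding no_short_cycle_def
  proof (intro conjI allI impI notI)
    fix a b c assume "adj G a b \<and> adj G b c" "adj G c a"
    then show False using tri by blast
  next
    fix a b c d
    assume "distinct [a, b, c, d] \<and> adj G a b \<and> adj G b c \<and> adj G c d" "adj G d a"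
    then have "cycle G [a, b, c, d]"
      using adj_verts[OF G] by (auto simp: cycle_def walk_def)
    from *[OF this] show False by simp
  next
    fix a b c d e
    assume "distinct [a, b, c, d, e] \<and> adj G a b \<and> adj G b c \<and> adj G c d \<and> adj G d e" "adj G e a"
    then have "cycle G [a, b, c, d, e]"
      using adj_verts[OF G] by (auto simp: cycle_def walk_def)
    from *[OF this] show False by simp
  next
    fix a b c d e f
    assume "distinct [a, b, c, d, e, f] \<and> adj G a b \<and> adj G b c \<and> adj G c d \<and> adj G d e
        \<and> adj G e f" "adj G f a"
    then have "cycle G [a, b, c, d, e, f]"
      using adj_verts[OF G] by (auto simp: cycle_def walk_def)
    from *[OF this] show False by simp
  qed
next
  assume no: "no_short_cycle G"
  have "7 \<le> length xs" if "cycle G xs" for xs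
  proof (rule ccontr)
    assume "\<not> 7 \<le> length xs"
    moreover have "3 \<le> length xs" using that by (simp add: cycle_def)
    ultimately consider "length xs = 3" | "length xs = 4" | "length xs = 5" | "length xs = 6"
      by linarith
    then show False
    proof cases
      case 1
      then obtain a b c where "xs = [a, b, c]"
        by (auto simp: numeral_eq_Suc length_Suc_conv)
      with that no_short_cycleD(1)[OF no] show False by (auto simp: cycle_def walk_def)
    next
      case 2
      then obtain a b c d where "xs = [a, b, c, d]"
        by (auto simp: numeral_eq_Suc length_Suc_conv)
      with that no_short_cycleD(2)[OF no] show False by (auto simp: cycle_def walk_def)
    next
      case 3
      then obtain a b c d e where "xs = [a, b, c, d, e]"
        by (auto simp: numeral_eq_Suc length_Suc_conv)
      with that no_short_cycleD(3)[OF no] show False by (auto simp: cycle_def walk_def)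
    next
      case 4
      then obtain a b c d e f where "xs = [a, b, c, d, e, f]"
        by (auto simp: numeral_eq_Suc length_Suc_conv)
      with that no_short_cycleD(4)[OF no] show False by (auto simp: cycle_def walk_def)
    qed
  qed
  then have "enat 7 \<le> girth G" using girth_ge_iff by blast
  then show "7 \<le> girth G" by (simp add: numeral_eq_enat)
qed

lemma no_short_cycle_mono:
  assumes "no_short_cycle G" "\<And>u v. adj F u v \<Longrightarrow> adj G u v"
  shows "no_short_cycle F"
  unfolding no_short_cycle_def
proof (intro conjI allI impI notI, goal_cases)
  case (1 a b c)
  then show ?case using no_short_cycleD(1)[OF assms(1), of a b c] assms(2) by blast
next
  case (2 a b c d)
  then show ?case using no_short_cycleD(2)[OF assms(1), of a b c d] assms(2) by blast
next
  case (3 a b c d e)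
  then show ?case using no_short_cycleD(3)[OF assms(1), of a b c d e] assms(2) by blast
next
  case (4 a b c d e f)
  then show ?case using no_short_cycleD(4)[OF assms(1), of a b c d e f] assms(2) by blast
qed

section \<open>Distance at most two and squares\<close>

lemma INF_enat_le_iff:
  "(INF x\<in>A. enat (f x)) \<le> enat n \<longleftrightarrow> (\<exists>x\<in>A. f x \<le> n)"
proof
  assume le: "(INF x\<in>A. enat (f x)) \<le> enat n"
  \<comment> \<open>The empty set has infimum \<infinity>, which no finite bound admits; a nonempty
    set of extended naturals attains its infimum.\<close>
  then have "A \<noteq> {}" by (auto simp: top_enat_def)
  then have "(INF x\<in>A. enat (f x)) \<in> (\<lambda>x. enat (f x)) ` A"
    by (metis Inf_enat_def LeastI ex_in_conv image_is_empty)
  with le show "\<exists>x\<in>A. f x \<le> n" by auto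
next
  assume "\<exists>x\<in>A. f x \<le> n"
  then show "(INF x\<in>A. enat (f x)) \<le> enat n"
    by (auto intro: INF_lower2)
qed

lemma gdist_le_2_iff:
  assumes H: "simple_graph H" and uv: "u \<in> verts H" "v \<in> verts H" "u \<noteq> v"
  shows "gdist H u v \<le> 2 \<longleftrightarrow> adj H u v \<or> (\<exists>z. adj H u z \<and> adj H z v)"
proof -
  have "gdist H u v \<le> 2 \<longleftrightarrow> (\<exists>xs\<in>walks_between H u v. length xs - 1 \<le> 2)"
    using INF_enat_le_iff[where n = 2] by (simp add: gdist_def numeral_eq_enat)
  also have "\<dots> \<longleftrightarrow> adj H u v \<or> (\<exists>z. adj H u z \<and> adj H z v)"
  proof
    assume "\<exists>xs\<in>walks_between H u v. length xs - 1 \<le> 2"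
    then obtain xs where xs: "walk H xs" "hd xs = u" "last xs = v" "length xs \<le> 3"
      by (auto simp: walks_between_def)
    then obtain ys where ys: "xs = u # ys" by (cases xs) (auto simp: walk_def)
    \<comment> \<open>The one-vertex walk is ruled out by u \<noteq> v; the bound then leaves room
      for at most one interior vertex.\<close>
    with xs uv(3) obtain z zs where zs: "ys = z # zs" by (cases ys) auto
    show "adj H u v \<or> (\<exists>z. adj H u z \<and> adj H z v)"
    proof (cases zs)
      case Nil
      with xs ys zs show ?thesis by (simp add: walk_def)
    next
      case (Cons w ws)
      with xs ys zs have "ws = []" by simp
      with Cons xs ys zs show ?thesis by (auto simp: walk_def)
    qed
  next
    assume "adj H u v \<or> (\<exists>z. adj H u z \<and> adj H z v)"
    then consider "adj H u v" | z where "adj H u z" "adj H z v" by blast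
    then show "\<exists>xs\<in>walks_between H u v. length xs - 1 \<le> 2"
    proof cases
      case 1
      then show ?thesis
        using uv by (intro bexI[of _ "[u, v]"]) (auto simp: walks_between_def walk_def)
    next
      case 2
      then show ?thesis
        using uv adj_verts[OF H]
        by (intro bexI[of _ "[u, z, v]"]) (auto simp: walks_between_def walk_def)
    qed
  qed
  finally show ?thesis .
qed

lemma verts_square [simp]: "verts (square H) = verts H"
  by (simp add: square_def)

lemma adj_square_iff:
  assumes H: "simple_graph H"
  shows "adj (square H) u v \<longleftrightarrow> u \<noteq> v \<and> (adj H u v \<or> (\<exists>z. adj H u z \<and> adj H z v))"
proof -
  \<comment> \<open>An edge can be listed in either order, so both distances occur until
    \<open>gdist_le_2_iff\<close> shows the condition to be symmetric.\<close>
  have "adj (square H) u v \<longleftrightarrow>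
      u \<in> verts H \<and> v \<in> verts H \<and> u \<noteq> v \<and> (gdist H u v \<le> 2 \<or> gdist H v u \<le> 2)"
    by (auto simp: adj_def square_def doubleton_eq_iff)
  then show ?thesis
    using gdist_le_2_iff[OF H] adj_verts[OF H] adj_commute[of H] by metis
qed

lemma simple_graph_square: "simple_graph H \<Longrightarrow> simple_graph (square H)"
  by (auto simp: simple_graph_def square_def)

lemma ugraph_eqI:
  assumes G: "simple_graph G" and H: "simple_graph H"
    and "verts G = verts H" "\<And>u v. adj G u v \<longleftrightarrow> adj H u v"
  shows "G = H"
proof -
  have "e \<in> edges G \<longleftrightarrow> e \<in> edges H" for e
    using edgeE[OF G] edgeE[OF H] assms(4) unfolding adj_def by metis
  with assms(3) show ?thesis by (intro ugraph.equality) auto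
qed

section \<open>Maximal cliques and forced edges\<close>

lemma clique_extend:
  assumes "finite (verts G)" "clique G K"
  obtains Q where "maximal_clique G Q" "K \<subseteq> Q"
proof -
  have "finite {Q. clique G Q}"
    by (rule finite_subset[of _ "Pow (verts G)"]) (auto simp: clique_def assms)
  with finite_has_maximal2[of "{Q. clique G Q}" K] assms(2)
  obtain Q where "clique G Q" "K \<subseteq> Q" "\<forall>Q'. clique G Q' \<longrightarrow> Q \<subseteq> Q' \<longrightarrow> Q = Q'"
    by auto
  then have "maximal_clique G Q" by (auto simp: maximal_clique_def)
  with \<open>K \<subseteq> Q\<close> that show ?thesis by blast
qed

lemma maximal_cliqueD:
  assumes "maximal_clique G Q"
  shows "Q \<subseteq> verts G"
    and "u \<in> Q \<Longrightarrow> v \<in> Q \<Longrightarrow> u \<noteq> v \<Longrightarrow> adj G u v"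
    and "clique G K \<Longrightarrow> Q \<subseteq> K \<Longrightarrow> K = Q"
proof -
  show "Q \<subseteq> verts G" "u \<in> Q \<Longrightarrow> v \<in> Q \<Longrightarrow> u \<noteq> v \<Longrightarrow> adj G u v"
    using assms by (simp_all add: maximal_clique_def clique_def)
  show "clique G K \<Longrightarrow> Q \<subseteq> K \<Longrightarrow> K = Q"
    using assms by (metis maximal_clique_def psubsetI)
qed

text \<open>An edge is a clique and extends to a maximal one. Hence adjacency is determined by the
  maximal cliques, which is how the constructed root is checked in \<open>ex_root\<close>.\<close>

lemma adj_iff_maximal_clique:
  assumes "simple_graph G"
  shows "adj G u v \<longleftrightarrow> u \<noteq> v \<and> (\<exists>Q. maximal_clique G Q \<and> u \<in> Q \<and> v \<in> Q)"
proof
  assume uv: "adj G u v"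
  then have "clique G {u, v}"
    using adj_verts[OF assms] adj_commute[of G] by (auto simp: clique_def)
  with uv show "u \<noteq> v \<and> (\<exists>Q. maximal_clique G Q \<and> u \<in> Q \<and> v \<in> Q)"
    using clique_extend[of G "{u, v}"] assms adj_irrefl[OF assms]
    by (metis insert_subset simple_graph_def)
next
  assume "u \<noteq> v \<and> (\<exists>Q. maximal_clique G Q \<and> u \<in> Q \<and> v \<in> Q)"
  then show "adj G u v" using maximal_cliqueD(2) by metis
qed

lemma simple_graph_forced_subgraph:
  assumes "simple_graph G"
  shows "simple_graph (forced_subgraph G)"
proof -
  have "\<Union>{e. forced_edge G e} \<subseteq> verts G"
    using assms by (auto simp: forced_edge_def simple_graph_def)
  then have "finite (\<Union>{e. forced_edge G e})"
    using assms by (auto simp: simple_graph_def intro: finite_subset)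
  moreover have "card e = 2" if "forced_edge G e" for e
    using that assms by (auto simp: forced_edge_def simple_graph_def)
  ultimately show ?thesis
    by (auto simp: forced_subgraph_def simple_graph_def)
qed

lemma adj_forced_subgraph:
  "adj (forced_subgraph G) u v \<longleftrightarrow> adj G u v \<and> (\<exists>Q1 Q2. maximal_clique G Q1 \<and>
     maximal_clique G Q2 \<and> Q1 \<noteq> Q2 \<and> {u, v} \<subseteq> Q1 \<and> {u, v} \<subseteq> Q2)"
  by (simp add: forced_subgraph_def adj_def forced_edge_def)

lemma verts_forced_subgraph:
  assumes "simple_graph G"
  shows "verts (forced_subgraph G) = {v. \<exists>w. adj (forced_subgraph G) v w}"
proof (intro set_eqI iffI)
  fix v assume "v \<in> verts (forced_subgraph G)"
  then obtain e where e: "v \<in> e" "e \<in> edges (forced_subgraph G)"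
    by (auto simp: forced_subgraph_def)
  from e(2) obtain a b where "e = {a, b}" "adj (forced_subgraph G) a b"
    using edgeE[OF simple_graph_forced_subgraph[OF assms]] by metis
  with e(1) show "v \<in> {v. \<exists>w. adj (forced_subgraph G) v w}"
    using adj_commute[of "forced_subgraph G"] by auto
next
  fix v assume "v \<in> {v. \<exists>w. adj (forced_subgraph G) v w}"
  then show "v \<in> verts (forced_subgraph G)"
    using adj_verts[OF simple_graph_forced_subgraph[OF assms]] by auto
qed

section \<open>Closed neighbourhoods and stars\<close>

definition closed_nbhd :: "'a ugraph \<Rightarrow> 'a \<Rightarrow> 'a set" where
  "closed_nbhd G v = insert v {w. adj G v w}"

lemma closed_nbhd_commute: "u \<in> closed_nbhd G v \<longleftrightarrow> v \<in> closed_nbhd G u"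
  using adj_commute[of G u v] by (auto simp: closed_nbhd_def)

text \<open>A third common element would form a triangle with v and w.\<close>

lemma closed_nbhd_Int:
  assumes "no_short_cycle G" "adj G v w"
  shows "closed_nbhd G v \<inter> closed_nbhd G w = {v, w}"
proof -
  have "\<not> (adj G v x \<and> adj G w x)" for x
    using no_short_cycleD(1)[OF assms, of x] adj_commute[of G v x] by blast
  then show ?thesis
    using assms(2) adj_commute[of G v w] by (auto simp: closed_nbhd_def)
qed

text \<open>In a triangle-free graph the neighbours of a centre are independent, so the star
  condition reduces to a dominating centre c; the edge cd accounts for the two vertices that a star
  must have.\<close>

lemma star_induced_iff:
  assumes F: "simple_graph F" and tf: "no_short_cycle F"
    and ne: "\<And>v. v \<in> verts F \<Longrightarrow> \<exists>w. adj F v w"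
  shows "star (induced_subgraph F (Q \<inter> verts F)) \<longleftrightarrow>
    (\<exists>c d. c \<in> Q \<and> d \<in> Q \<and> adj F c d \<and> Q \<inter> verts F \<subseteq> closed_nbhd F c)"
    (is "star ?S \<longleftrightarrow> ?R")
proof -
  have vS: "verts ?S = Q \<inter> verts F"
    by (auto simp: induced_subgraph_def)
  have aS: "adj ?S u v \<longleftrightarrow> adj F u v" if "u \<in> Q \<inter> verts F" "v \<in> Q \<inter> verts F" for u v
    using that by (auto simp: adj_def induced_subgraph_def)
  have fin: "finite (Q \<inter> verts F)" using F by (simp add: simple_graph_def)
  show ?thesis
  proof
    assume "star ?S"
    then obtain c where c: "c \<in> Q \<inter> verts F" "\<forall>v\<in>Q \<inter> verts F - {c}. adj F c v"
      and "2 \<le> card (Q \<inter> verts F)"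
      using aS unfolding star_def vS by (metis DiffD1)
    then have "\<not> Q \<inter> verts F \<subseteq> {c}"
      using card_mono[of "{c}" "Q \<inter> verts F"] by auto
    then obtain d where "d \<in> Q \<inter> verts F" "d \<noteq> c" by blast
    with c show ?R by (auto simp: closed_nbhd_def)
  next
    assume ?R
    then obtain c d where cd: "c \<in> Q" "d \<in> Q" "adj F c d"
      and sub: "Q \<inter> verts F \<subseteq> closed_nbhd F c" by blast
    from cd have ver: "c \<in> verts F" "d \<in> verts F" "c \<noteq> d"
      using adj_verts[OF F] adj_irrefl[OF F] by auto
    then have "card {c, d} \<le> card (Q \<inter> verts F)"
      using cd fin by (intro card_mono) auto
    with ver have "2 \<le> card (verts ?S)" unfolding vS by simp
    moreover have "\<not> adj F u v" if "adj F c u" "adj F c v" for u v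
      using that no_short_cycleD(1)[OF tf] adj_commute[of F] by blast
    ultimately show "star ?S"
      unfolding star_def vS using sub cd ver aS
      by (intro conjI bexI[of _ c]) (auto simp: closed_nbhd_def)
  qed
qed

section \<open>Squares of graphs of girth at least seven\<close>

text \<open>Connectedness and non-completeness are assumed of the square, because the theorem
  assumes them of G; connectedness of H is recovered in \<open>reachable\<close>.\<close>

locale large_girth_root =
  fixes H :: "'a ugraph"
  assumes simple: "simple_graph H"
    and nsc: "no_short_cycle H"
    and conn: "connected_graph (square H)"
    and noncomplete: "\<not> complete_graph (square H)"
begin

text \<open>Degree at least two, given by two witnesses instead of a cardinality. By
  \<open>leaf_neighbour\<close> all other vertices are leaves.\<close>

definition inner :: "'a set" where
  "inner = {v. \<exists>a b. a \<noteq> b \<and> adj H v a \<and> adj H v b}"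

lemmas irrefl = adj_irrefl[OF simple]
lemmas in_verts = adj_verts[OF simple]
lemmas sym = adj_commute[of H]
lemmas triangle_free = no_short_cycleD(1)[OF nsc]
lemmas adj_sq = adj_square_iff[OF simple]
lemmas simple_sq = simple_graph_square[OF simple]

lemma inner_verts: "v \<in> inner \<Longrightarrow> v \<in> verts H"
  using in_verts by (auto simp: inner_def)

text \<open>Two common neighbours of u and v would close a 4-cycle.\<close>

lemma common_neighbour_unique:
  assumes "adj H u w" "adj H w v" "adj H u z" "adj H z v" "u \<noteq> v"
  shows "z = w"
proof (rule ccontr)
  assume "z \<noteq> w"
  with assms have "distinct [u, w, v, z]" using irrefl by auto
  with assms show False
    using no_short_cycleD(2)[OF nsc, of u w v z] sym by blast
qed

text \<open>Paths of length at most two from x to u and to v, joined with the path u, w, v, close a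
  cycle of length 4, 5 or 6 if x lies outside N[w]. The four cases below are the possible lengths of
  these two paths.\<close>

lemma close_to_ends:
  assumes w: "adj H u w" "adj H w v" "u \<noteq> v"
    and xu: "adj (square H) x u" and xv: "adj (square H) x v"
  shows "x \<in> closed_nbhd H w"
proof (rule ccontr)
  assume "x \<notin> closed_nbhd H w"
  then have xw: "x \<noteq> w" "\<not> adj H w x" "\<not> adj H x w"
    using sym by (auto simp: closed_nbhd_def)
  have uv: "\<not> adj H u v" "\<not> adj H v u"
    using triangle_free w sym by blast+
  have ne: "x \<noteq> u" "x \<noteq> v" "u \<noteq> w" "v \<noteq> w"
    using xu xv adj_sq w irrefl by blast+
  consider "adj H x u" "adj H x v" | z where "adj H x u" "adj H x z" "adj H z v"
    | y where "adj H x y" "adj H y u" "adj H x v"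
    | y z where "adj H x y" "adj H y u" "adj H x z" "adj H z v"
    using xu xv adj_sq by metis
  then show False
  proof cases
    case 1
    then show False using common_neighbour_unique[OF w(1,2) _ _ w(3), of x] xw sym by blast
  next
    case 2
    then have "distinct [x, u, w, v, z]" using ne uv xw irrefl w by auto
    then show False
      using no_short_cycleD(3)[OF nsc, of x u w v z] 2 w sym by blast
  next
    case 3
    then have "distinct [x, y, u, w, v]" using ne uv xw irrefl w by auto
    then show False
      using no_short_cycleD(3)[OF nsc, of x y u w v] 3 w sym by blast
  next
    case 4
    \<comment> \<open>If y = z, this vertex would be a common neighbour of u and v, hence w, and x
      would be adjacent to w.\<close>
    have "y \<noteq> z"
      using common_neighbour_unique[OF w(1,2) _ _ w(3), of y] 4 xw sym by blast
    then have "distinct [x, y, u, w, v, z]" using 4 ne uv xw irrefl w by auto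
    then show False
      using no_short_cycleD(4)[OF nsc, of x y u w v z] 4 w sym by blast
  qed
qed

text \<open>Two members not adjacent in H have a middle vertex w, and \<open>close_to_ends\<close>
  forces all other members into N[w]. If no such pair exists, any member of K serves as the
  centre.\<close>

lemma clique_subset_closed_nbhd:
  assumes K: "clique (square H) K" and "K \<noteq> {}"
  shows "\<exists>v\<in>verts H. K \<subseteq> closed_nbhd H v"
proof (cases "\<exists>u\<in>K. \<exists>v\<in>K. u \<noteq> v \<and> \<not> adj H u v")
  case True
  then obtain u v where uv: "u \<in> K" "v \<in> K" "u \<noteq> v" "\<not> adj H u v" by blast
  with K have "adj (square H) u v" by (auto simp: clique_def)
  with uv obtain w where w: "adj H u w" "adj H w v" using adj_sq by metis
  have "x \<in> closed_nbhd H w" if "x \<in> K" for x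
  proof (cases "x = u \<or> x = v")
    case True
    with w show ?thesis using sym by (auto simp: closed_nbhd_def)
  next
    case False
    with that K uv have "adj (square H) x u" "adj (square H) x v" by (auto simp: clique_def)
    with w uv show ?thesis using close_to_ends by blast
  qed
  then show ?thesis using w in_verts by blast
next
  case False
  from assms obtain v where v: "v \<in> K" by blast
  with K have "v \<in> verts H" by (auto simp: clique_def)
  moreover have "K \<subseteq> closed_nbhd H v"
    using False v by (auto simp: closed_nbhd_def)
  ultimately show ?thesis by blast
qed

lemma clique_closed_nbhd:
  assumes "v \<in> verts H"
  shows "clique (square H) (closed_nbhd H v)"
proof -
  have "a \<in> verts H \<and> adj H a v" if "adj H v a" for a
    using in_verts[OF that] that sym[of v a] by simp
  with assms show ?thesis
    unfolding clique_def closed_nbhd_def adj_sq verts_square by blast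
qed

lemma reachable:
  assumes "u \<in> verts H" "v \<in> verts H"
  shows "(adj H)\<^sup>*\<^sup>* u v"
proof -
  have "(adj (square H))\<^sup>*\<^sup>* u v"
    using conn assms connected_graph_iff[OF simple_sq] by simp
  moreover have "(adj H)\<^sup>*\<^sup>* a b" if "adj (square H) a b" for a b
    using that unfolding adj_sq by (auto intro: rtranclp_trans)
  ultimately show ?thesis
    by (induction) (auto intro: rtranclp_trans)
qed

text \<open>Without an edge leaving it, N[v] would be all of H by connectedness; being a clique of
  the square, it would make the square complete. This is where non-completeness enters.\<close>

lemma closed_nbhd_not_closed:
  assumes "v \<in> verts H"
  shows "\<exists>a\<in>closed_nbhd H v. \<exists>b. adj H a b \<and> b \<notin> closed_nbhd H v"
proof (rule ccontr)
  assume "\<not> ?thesis"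
  then have "b \<in> closed_nbhd H v" if "a \<in> closed_nbhd H v" "adj H a b" for a b
    using that by blast
  then have "verts H \<subseteq> closed_nbhd H v"
    using rtranclp_closed[OF reachable[OF assms], of _ "closed_nbhd H v"]
    by (auto simp: closed_nbhd_def)
  with clique_closed_nbhd[OF assms] noncomplete show False
    unfolding complete_graph_def clique_def verts_square by blast
qed

text \<open>The edge ab leaving N[v] cannot start at v, so a is a neighbour of v with the two
  neighbours v and b.\<close>

lemma inner_has_inner_neighbour:
  assumes "v \<in> inner"
  shows "\<exists>w\<in>inner. adj H v w"
proof -
  obtain a b where ab: "a \<in> closed_nbhd H v" "adj H a b" "b \<notin> closed_nbhd H v"
    using closed_nbhd_not_closed inner_verts[OF assms] by blast
  then have va: "adj H v a" "b \<noteq> v" by (auto simp: closed_nbhd_def)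
  with ab have "a \<in> inner" using sym unfolding inner_def by blast
  with va show ?thesis by blast
qed

lemma leaf_neighbour:
  assumes "v \<in> verts H" "v \<notin> inner"
  shows "\<exists>w\<in>inner. {w. adj H v w} = {w}"
proof -
  obtain a b where ab: "a \<in> closed_nbhd H v" "adj H a b" "b \<notin> closed_nbhd H v"
    using closed_nbhd_not_closed assms by blast
  then have va: "adj H v a" "b \<noteq> v" by (auto simp: closed_nbhd_def)
  with ab have "a \<in> inner" using sym unfolding inner_def by blast
  moreover have "{w. adj H v w} = {a}" using va assms(2) by (auto simp: inner_def)
  ultimately show ?thesis by blast
qed

text \<open>An inner v has a neighbour other than w, and that neighbour would form a triangle with v
  and w. For a leaf this fails: its closed neighbourhood lies in that of its neighbour.\<close>

lemma closed_nbhd_subset: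
  assumes "v \<in> inner" "closed_nbhd H v \<subseteq> closed_nbhd H w"
  shows "w = v"
proof (rule ccontr)
  assume "w \<noteq> v"
  with assms(2) have wv: "adj H w v" by (auto simp: closed_nbhd_def)
  from assms(1) obtain a where "adj H v a" "a \<noteq> w" unfolding inner_def by blast
  moreover from this assms(2) have "adj H w a" by (auto simp: closed_nbhd_def)
  ultimately show False using triangle_free wv sym by blast
qed

text \<open>A maximal clique fills the closed neighbourhood that covers it. If the centre were a
  leaf, the neighbourhood of its inner neighbour would be a strictly larger clique. Conversely,
  \<open>closed_nbhd_subset\<close> prevents N[v] with v inner from lying in another closed
  neighbourhood.\<close>

lemma maximal_clique_square_iff:
  "maximal_clique (square H) Q \<longleftrightarrow> (\<exists>v\<in>inner. Q = closed_nbhd H v)"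
proof
  assume Q: "maximal_clique (square H) Q"
  \<comment> \<open>The covering lemma needs a nonempty clique; the empty set is not maximal because
    H has a vertex.\<close>
  have "Q \<noteq> {}"
  proof
    assume "Q = {}"
    obtain x where x: "x \<in> verts H" using conn by (auto simp: connected_graph_def)
    have "closed_nbhd H x = Q"
      using maximal_cliqueD(3)[OF Q clique_closed_nbhd[OF x]] \<open>Q = {}\<close> by simp
    with \<open>Q = {}\<close> show False by (simp add: closed_nbhd_def)
  qed
  with Q obtain v where v: "v \<in> verts H" "Q \<subseteq> closed_nbhd H v"
    using clique_subset_closed_nbhd unfolding maximal_clique_def by blast
  then have Qv: "Q = closed_nbhd H v"
    using maximal_cliqueD(3)[OF Q clique_closed_nbhd] by blast
  have "v \<in> inner"
  proof (rule ccontr)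
    assume "v \<notin> inner"
    then obtain w where w: "w \<in> inner" "{w. adj H v w} = {w}"
      using leaf_neighbour v(1) by blast
    then have "Q \<subseteq> closed_nbhd H w"
      unfolding Qv closed_nbhd_def using sym by auto
    then have "closed_nbhd H w = Q"
      using maximal_cliqueD(3)[OF Q clique_closed_nbhd] inner_verts w(1) by blast
    with Qv w(1) have "v = w" using closed_nbhd_subset by blast
    with w \<open>v \<notin> inner\<close> show False by blast
  qed
  with Qv show "\<exists>v\<in>inner. Q = closed_nbhd H v" by blast
next
  assume "\<exists>v\<in>inner. Q = closed_nbhd H v"
  then obtain v where v: "v \<in> inner" "Q = closed_nbhd H v" by blast
  have "K = Q" if K: "clique (square H) K" "Q \<subseteq> K" for K
  proof -
    have "K \<noteq> {}" using K v by (auto simp: closed_nbhd_def)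
    then obtain w where "K \<subseteq> closed_nbhd H w" using clique_subset_closed_nbhd K by blast
    moreover from this have "w = v" using closed_nbhd_subset v K by blast
    ultimately show ?thesis using v K by blast
  qed
  then show "maximal_clique (square H) Q"
    using v clique_closed_nbhd inner_verts unfolding maximal_clique_def by blast
qed

text \<open>If v and w were not adjacent, x and y would be two common neighbours of them; if they
  are adjacent, \<open>closed_nbhd_Int\<close> applies.\<close>

lemma two_in_two_closed_nbhds:
  assumes "v \<noteq> w" "x \<noteq> y" "{x, y} \<subseteq> closed_nbhd H v" "{x, y} \<subseteq> closed_nbhd H w"
  shows "{x, y} = {v, w} \<and> adj H v w"
proof -
  have "adj H v w"
  proof (rule ccontr)
    assume "\<not> adj H v w"
    moreover from this have "\<not> adj H w v" using sym by blast
    ultimately have "adj H v x" "adj H x w" "adj H v y" "adj H y w"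
      using assms sym by (auto simp: closed_nbhd_def)
    then show False using common_neighbour_unique assms by blast
  qed
  moreover from closed_nbhd_Int[OF nsc this] assms have "{x, y} \<subseteq> {v, w}" by blast
  ultimately show ?thesis using assms(1,2) by auto
qed

section \<open>The forced subgraph of the square and conditions (i)-(v)\<close>

abbreviation F where "F \<equiv> forced_subgraph (square H)"

text \<open>An edge inside two cliques N[a] and N[b] is the edge ab itself. Conversely, an edge uv
  between inner vertices lies in N[u] and N[v], which are distinct maximal cliques.\<close>

lemma adj_forced_iff: "adj F u v \<longleftrightarrow> u \<in> inner \<and> v \<in> inner \<and> adj H u v"
proof
  assume "adj F u v"
  then obtain Q1 Q2 where "adj (square H) u v" "maximal_clique (square H) Q1"
    "maximal_clique (square H) Q2" "Q1 \<noteq> Q2" "{u, v} \<subseteq> Q1" "{u, v} \<subseteq> Q2"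
    unfolding adj_forced_subgraph by blast
  moreover from this obtain a b where "a \<in> inner" "b \<in> inner"
    "Q1 = closed_nbhd H a" "Q2 = closed_nbhd H b"
    unfolding maximal_clique_square_iff by blast
  moreover from calculation have "u \<noteq> v" "a \<noteq> b" using adj_sq by blast+
  ultimately show "u \<in> inner \<and> v \<in> inner \<and> adj H u v"
    using two_in_two_closed_nbhds[of a b u v] sym by (auto simp: doubleton_eq_iff)
next
  assume uv: "u \<in> inner \<and> v \<in> inner \<and> adj H u v"
  then have "{u, v} \<subseteq> closed_nbhd H u" "{u, v} \<subseteq> closed_nbhd H v"
    using sym by (auto simp: closed_nbhd_def)
  moreover have "closed_nbhd H u \<noteq> closed_nbhd H v"
    using uv closed_nbhd_subset irrefl by (metis subset_refl)
  moreover have "adj (square H) u v" using uv irrefl adj_sq by blast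
  ultimately show "adj F u v"
    unfolding adj_forced_subgraph maximal_clique_square_iff using uv by blast
qed

lemma simple_forced: "simple_graph F"
  using simple_graph_forced_subgraph simple_sq by blast

lemma verts_forced: "verts F = inner"
  using inner_has_inner_neighbour
  unfolding verts_forced_subgraph[OF simple_sq] adj_forced_iff by blast

lemma forced_edgeE:
  assumes "e \<in> edges F"
  obtains u v where "e = {u, v}" "u \<noteq> v" "u \<in> inner" "v \<in> inner" "adj H u v"
  using edgeE[OF simple_forced assms] adj_forced_iff by metis

lemma nsc_forced: "no_short_cycle F"
  using no_short_cycle_mono[OF nsc] adj_forced_iff by blast

text \<open>Condition (i): the neighbour of a leaf is the only inner vertex whose closed
  neighbourhood contains the leaf.\<close>

lemma outer_unique_clique:
  assumes "v \<in> verts H - inner"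
  shows "\<exists>!Q. maximal_clique (square H) Q \<and> v \<in> Q"
proof -
  obtain w where w: "w \<in> inner" "{w. adj H v w} = {w}"
    using leaf_neighbour assms by blast
  show ?thesis
  proof (rule ex1I[of _ "closed_nbhd H w"])
    show "maximal_clique (square H) (closed_nbhd H w) \<and> v \<in> closed_nbhd H w"
      using w sym unfolding maximal_clique_square_iff closed_nbhd_def by auto
  next
    fix Q assume "maximal_clique (square H) Q \<and> v \<in> Q"
    then obtain x where "x \<in> inner" "Q = closed_nbhd H x" "v \<in> Q"
      unfolding maximal_clique_square_iff by blast
    moreover from this assms w have "x = w" using sym by (auto simp: closed_nbhd_def)
    ultimately show "Q = closed_nbhd H w" by simp
  qed
qed

lemma forced_edge_two_cliques:
  assumes "e \<in> edges F"
  shows "card {Q. maximal_clique (square H) Q \<and> e \<subseteq> Q} = 2"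
proof -
  obtain u v where uv: "e = {u, v}" "u \<noteq> v" "u \<in> inner" "v \<in> inner" "adj H u v"
    using forced_edgeE assms by blast
  have "{Q. maximal_clique (square H) Q \<and> e \<subseteq> Q} = {closed_nbhd H u, closed_nbhd H v}"
  proof (intro set_eqI iffI)
    fix Q assume "Q \<in> {Q. maximal_clique (square H) Q \<and> e \<subseteq> Q}"
    then obtain x where x: "x \<in> inner" "Q = closed_nbhd H x" "u \<in> closed_nbhd H x"
      "v \<in> closed_nbhd H x"
      unfolding maximal_clique_square_iff uv by blast
    \<comment> \<open>Since closed neighbourhoods are symmetric, a centre whose clique contains u
      and v lies in N[u] and N[v], which meet only in u and v.\<close>
    then have "x \<in> closed_nbhd H u \<inter> closed_nbhd H v"
      using closed_nbhd_commute[of x H] by simp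
    then have "x = u \<or> x = v"
      using closed_nbhd_Int[OF nsc uv(5)] by blast
    with x show "Q \<in> {closed_nbhd H u, closed_nbhd H v}" by blast
  next
    fix Q assume "Q \<in> {closed_nbhd H u, closed_nbhd H v}"
    then show "Q \<in> {Q. maximal_clique (square H) Q \<and> e \<subseteq> Q}"
      using uv sym unfolding maximal_clique_square_iff closed_nbhd_def by auto
  qed
  moreover have "closed_nbhd H u \<noteq> closed_nbhd H v"
    using uv closed_nbhd_subset by (metis subset_refl)
  ultimately show ?thesis by simp
qed

text \<open>Condition (iii): the closed neighbourhood of the shared endpoint contains both
  edges.\<close>

lemma forced_edges_common_clique:
  assumes "e \<in> edges F" "f \<in> edges F" "e \<inter> f \<noteq> {}"
  shows "\<exists>Q. maximal_clique (square H) Q \<and> e \<subseteq> Q \<and> f \<subseteq> Q"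
proof -
  obtain x where x: "x \<in> e" "x \<in> f" using assms by blast
  have *: "x \<in> inner \<and> g \<subseteq> closed_nbhd H x" if "x \<in> g" "g \<in> edges F" for g
    using that(2,1) by (elim forced_edgeE) (use sym in \<open>auto simp: closed_nbhd_def\<close>)
  with x assms show ?thesis unfolding maximal_clique_square_iff by blast
qed

text \<open>Condition (iv): the clique N[v] has v as star centre, and an inner neighbour of v
  supplies the required edge.\<close>

lemma star_forced:
  assumes "maximal_clique (square H) Q"
  shows "star (induced_subgraph F (Q \<inter> verts F))"
proof -
  obtain v where v: "v \<in> inner" "Q = closed_nbhd H v"
    using assms maximal_clique_square_iff by blast
  moreover obtain w where "w \<in> inner" "adj H v w"
    using inner_has_inner_neighbour v by blast
  ultimately have "\<exists>c d. c \<in> Q \<and> d \<in> Q \<and> adj F c d \<and> Q \<inter> verts F \<subseteq> closed_nbhd F c"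
    unfolding verts_forced closed_nbhd_def adj_forced_iff by auto
  moreover have "\<exists>w. adj F x w" if "x \<in> verts F" for x
    using that verts_forced_subgraph[OF simple_sq] by blast
  ultimately show ?thesis using star_induced_iff[OF simple_forced nsc_forced] by blast
qed

text \<open>Moving every leaf to its neighbour turns walks of \<open>H\<close> into walks of \<open>F\<close>.\<close>

lemma connected_forced: "connected_graph F"
proof -
  \<comment> \<open>At a leaf the choice is forced by uniqueness of the neighbour, as
    \<open>p_leaf\<close> records.\<close>
  define p where "p x = (if x \<in> inner then x else SOME w. adj H x w)" for x
  have p_leaf: "p x = y" if "adj H x y" "x \<notin> inner" for x y
  proof -
    have "adj H x (SOME w. adj H x w)" using that(1) by (rule someI)
    with that show ?thesis unfolding p_def inner_def by auto
  qed
  have lift_adj: "(adj F)\<^sup>*\<^sup>* (p x) (p y)" if xy: "adj H x y" for x y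
  proof (cases "x \<in> inner"; cases "y \<in> inner")
    assume "x \<in> inner" "y \<in> inner"
    with xy show ?thesis unfolding p_def using adj_forced_iff by auto
  next
    \<comment> \<open>An edge at a leaf collapses to a single vertex, which the reflexive closure
      absorbs.\<close>
    assume "x \<in> inner" "y \<notin> inner"
    with xy p_leaf[of y x] sym show ?thesis by (auto simp: p_def)
  next
    assume "x \<notin> inner" "y \<in> inner"
    with xy p_leaf[of x y] show ?thesis by (auto simp: p_def)
  next
    \<comment> \<open>This case is void, since the only neighbour of a leaf is inner.\<close>
    assume "x \<notin> inner" "y \<notin> inner"
    moreover obtain w where "w \<in> inner" "{w. adj H x w} = {w}"
      using leaf_neighbour in_verts[OF xy] \<open>x \<notin> inner\<close> by blast
    moreover from this xy have "y = w" by blast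
    ultimately show ?thesis by blast
  qed
  have lift: "(adj F)\<^sup>*\<^sup>* (p x) (p y)" if "(adj H)\<^sup>*\<^sup>* x y" for x y
    using that
  proof induction
    case (step y z)
    then show ?case using rtranclp_trans[OF step.IH] lift_adj by blast
  qed simp
  have "(adj F)\<^sup>*\<^sup>* u v" if "u \<in> inner" "v \<in> inner" for u v
    using lift[OF reachable[of u v]] that inner_verts unfolding p_def by simp
  moreover have "inner \<noteq> {}"
  proof -
    obtain x where x: "x \<in> verts H" using conn by (auto simp: connected_graph_def)
    then show ?thesis using leaf_neighbour by blast
  qed
  ultimately show ?thesis
    unfolding connected_graph_iff[OF simple_forced] verts_forced by blast
qed

end

section \<open>Construction of the square root\<close>

text \<open>Conditions (i)-(iv) are \<open>outer\<close>, \<open>two\<close>, \<open>common\<close>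
  and \<open>stars\<close>; (v) is split into \<open>conn\<close> and \<open>nsc\<close>, the latter
  being the girth bound in its cycle-by-cycle form.\<close>

locale root_conditions =
  fixes G F :: "'a ugraph"
  assumes simple: "simple_graph G"
    and F_def: "F = forced_subgraph G"
    and outer: "\<And>v. v \<in> verts G - verts F \<Longrightarrow> \<exists>!Q. maximal_clique G Q \<and> v \<in> Q"
    and two: "\<And>e. e \<in> edges F \<Longrightarrow> card {Q. maximal_clique G Q \<and> e \<subseteq> Q} = 2"
    and common: "\<And>e f. e \<in> edges F \<Longrightarrow> f \<in> edges F \<Longrightarrow> e \<noteq> f \<Longrightarrow> e \<inter> f \<noteq> {} \<Longrightarrow>
       \<exists>Q. maximal_clique G Q \<and> e \<subseteq> Q \<and> f \<subseteq> Q"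
    and stars: "\<And>Q. maximal_clique G Q \<Longrightarrow> star (induced_subgraph F (Q \<inter> verts F))"
    and conn: "connected_graph F"
    and nsc: "no_short_cycle F"
begin

lemma simpleF: "simple_graph F"
  using simple_graph_forced_subgraph simple F_def by blast

lemmas irrefl = adj_irrefl[OF simpleF]
lemmas in_verts = adj_verts[OF simpleF]
lemmas sym = adj_commute[of F]
lemmas triangle_free = no_short_cycleD(1)[OF nsc]

lemma verts_subset: "verts F \<subseteq> verts G"
  using simple unfolding F_def forced_subgraph_def forced_edge_def simple_graph_def by auto

lemma vertsF: "v \<in> verts F \<longleftrightarrow> (\<exists>w. adj F v w)"
  using verts_forced_subgraph[OF simple] F_def by auto

lemma adjF_imp_adj: "adj F u v \<Longrightarrow> adj G u v"
  unfolding F_def adj_forced_subgraph by blast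

section \<open>Maximal cliques attached to vertices of the forced subgraph\<close>

lemma two_cliques:
  assumes "adj F u v"
  obtains Q1 Q2 where "Q1 \<noteq> Q2"
    "{Q. maximal_clique G Q \<and> u \<in> Q \<and> v \<in> Q} = {Q1, Q2}"
  using two[of "{u, v}"] assms by (auto simp: adj_def card_2_iff)

lemma adjF_I:
  assumes "maximal_clique G Q1" "maximal_clique G Q2" "Q1 \<noteq> Q2" "u \<noteq> v"
    "u \<in> Q1" "v \<in> Q1" "u \<in> Q2" "v \<in> Q2"
  shows "adj F u v"
  using assms maximal_cliqueD(2)[OF assms(1)] unfolding F_def adj_forced_subgraph by blast

lemma clique_centre:
  assumes "maximal_clique G Q"
  obtains c d where "c \<in> Q" "d \<in> Q" "adj F c d" "Q \<inter> verts F \<subseteq> closed_nbhd F c"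
  using stars[OF assms] star_induced_iff[OF simpleF nsc, of Q] vertsF that by blast

text \<open>For two neighbours a and b of v in F, the edges va and vb meet in v, so condition (iii)
  puts them into one maximal clique of G.\<close>

lemma clique_closed_nbhd:
  assumes "v \<in> verts F"
  shows "clique G (closed_nbhd F v)"
proof -
  have "adj G a b" if "adj F v a" "adj F v b" "a \<noteq> b" for a b
  proof -
    have "{v, a} \<in> edges F" "{v, b} \<in> edges F" "{v, a} \<noteq> {v, b}" "{v, a} \<inter> {v, b} \<noteq> {}"
      using that by (auto simp: adj_def doubleton_eq_iff)
    then obtain Q where "maximal_clique G Q" "a \<in> Q" "b \<in> Q" using common by blast
    with that(3) show ?thesis using maximal_cliqueD(2) by metis
  qed
  moreover have "closed_nbhd F v \<subseteq> verts G"
    using assms in_verts verts_subset unfolding closed_nbhd_def by blast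
  moreover have "adj G v a \<and> adj G a v" if "adj F v a" for a
    using adjF_imp_adj[OF that] adj_commute[of G v a] by simp
  ultimately show ?thesis
    by (auto simp: clique_def closed_nbhd_def)
qed

text \<open>Extend the closed neighbourhood of v in F to a maximal clique Q. The star centre c of Q
  lies in the closed neighbourhoods of v, a and b; the first meets the other two only in {v, a} and
  {v, b}, so c = v and Q has no further vertices in F.\<close>

lemma clique_at_branching:
  assumes "adj F v a" "adj F v b" "a \<noteq> b"
  obtains Q where "maximal_clique G Q" "Q \<inter> verts F = closed_nbhd F v"
proof -
  have "finite (verts G)" using simple by (simp add: simple_graph_def)
  then obtain Q where Q: "maximal_clique G Q" "closed_nbhd F v \<subseteq> Q"
    using clique_extend clique_closed_nbhd in_verts assms(1) by metis
  obtain c d where c: "Q \<inter> verts F \<subseteq> closed_nbhd F c" using clique_centre Q(1) by blast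
  have sub: "closed_nbhd F v \<subseteq> Q \<inter> verts F"
    using Q in_verts assms(1) by (auto simp: closed_nbhd_def)
  then have vc: "{v, a, b} \<subseteq> closed_nbhd F c" using c assms by (auto simp: closed_nbhd_def)
  then have "c \<in> closed_nbhd F v" "c \<in> closed_nbhd F a" "c \<in> closed_nbhd F b"
    using closed_nbhd_commute[of c F] by simp_all
  then have "c = v"
    using closed_nbhd_Int[OF nsc assms(1)] closed_nbhd_Int[OF nsc assms(2)] assms(3) by blast
  with c sub Q that show ?thesis by blast
qed

text \<open>At an end vertex \<open>v\<close> of \<open>F\<close>, one of the two cliques on the edge \<open>vw\<close> belongs to the
  branching vertex \<open>w\<close>; the other one is the clique of \<open>v\<close>.\<close>

lemma clique_at_end:
  assumes "{w. adj F v w} = {w}" "adj F w a" "a \<noteq> v"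
  obtains Q where "maximal_clique G Q" "Q \<inter> verts F = closed_nbhd F v"
proof -
  have vw: "adj F v w" "adj F w v" using assms(1) sym by blast+
  obtain P where P: "maximal_clique G P" "P \<inter> verts F = closed_nbhd F w"
    using clique_at_branching[OF vw(2) assms(2)] assms(3) by metis
  obtain Q1 Q2 where "Q1 \<noteq> Q2" "{Q. maximal_clique G Q \<and> v \<in> Q \<and> w \<in> Q} = {Q1, Q2}"
    using two_cliques[OF vw(1)] by blast
  then obtain Q where Q: "maximal_clique G Q" "v \<in> Q" "w \<in> Q" "Q \<noteq> P" by blast
  obtain c d where c: "Q \<inter> verts F \<subseteq> closed_nbhd F c" using clique_centre Q(1) by blast
  \<comment> \<open>A further vertex x would force w to be the centre of Q and hence x into P. Then
    v and x lie in the distinct maximal cliques P and Q, so vx is forced, although w is the only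
    neighbour of v in F.\<close>
  have "x \<in> {v, w}" if x: "x \<in> Q \<inter> verts F" for x
  proof (rule ccontr)
    assume "x \<notin> {v, w}"
    then have "\<not> adj F v x" using assms(1) by blast
    moreover have "v \<in> closed_nbhd F c" "x \<in> closed_nbhd F c" using c x Q vw in_verts by blast+
    ultimately have "c = w"
      using assms(1) \<open>x \<notin> {v, w}\<close> sym unfolding closed_nbhd_def by blast
    then have wx: "adj F w x" using c x \<open>x \<notin> {v, w}\<close> by (auto simp: closed_nbhd_def)
    then have "x \<in> P" "v \<in> P" using P(2) vw by (auto simp: closed_nbhd_def)
    then have "adj F v x"
      using adjF_I[OF Q(1) P(1) Q(4), of v x] Q x \<open>x \<notin> {v, w}\<close> by blast
    with \<open>\<not> adj F v x\<close> show False by blast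
  qed
  then have "Q \<inter> verts F = {v, w}" using Q vw in_verts by blast
  moreover have "closed_nbhd F v = {v, w}" using assms(1) by (auto simp: closed_nbhd_def)
  ultimately show ?thesis using that Q(1) by blast
qed

text \<open>If F is a single edge, its ends have the same closed neighbourhood, and injectivity must
  come from the two cliques of condition (ii). Otherwise each vertex of F branches or is an end next
  to a branching vertex, and distinct vertices have distinct closed neighbourhoods, so any choice of
  cliques is injective.\<close>

lemma clique_indexing:
  obtains q where "\<And>v. v \<in> verts F \<Longrightarrow> maximal_clique G (q v)"
    "\<And>v. v \<in> verts F \<Longrightarrow> q v \<inter> verts F = closed_nbhd F v" "inj_on q (verts F)"
proof (cases "\<exists>v w. adj F v w \<and> verts F = {v, w}")
  case True
  then obtain v w where vw: "adj F v w" "verts F = {v, w}" by blast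
  have ne: "v \<noteq> w" using vw irrefl by blast
  obtain Q1 Q2 where Q: "Q1 \<noteq> Q2" "{Q. maximal_clique G Q \<and> v \<in> Q \<and> w \<in> Q} = {Q1, Q2}"
    using two_cliques[OF vw(1)] by blast
  have "maximal_clique G Q \<and> v \<in> Q \<and> w \<in> Q" if "Q \<in> {Q1, Q2}" for Q
    using that unfolding Q(2)[symmetric] by simp
  then have Q': "maximal_clique G Q1" "maximal_clique G Q2" "{v, w} \<subseteq> Q1" "{v, w} \<subseteq> Q2"
    by auto
  define q where "q x = (if x = v then Q1 else Q2)" for x
  have N: "closed_nbhd F v = {v, w}" "closed_nbhd F w = {v, w}"
    using vw sym in_verts unfolding closed_nbhd_def by blast+
  show ?thesis
  proof (rule that[of q])
    fix x assume "x \<in> verts F"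
    then show "maximal_clique G (q x)" using Q' by (simp add: q_def)
  next
    fix x assume "x \<in> verts F"
    then have "closed_nbhd F x = {v, w}" using vw(2) N by auto
    moreover have "{v, w} \<subseteq> q x" using Q' by (simp add: q_def)
    ultimately show "q x \<inter> verts F = closed_nbhd F x" using vw(2) by blast
  next
    show "inj_on q (verts F)" using Q(1) ne unfolding vw(2) q_def by (auto simp: inj_on_def)
  qed
next
  case False
  \<comment> \<open>If w had no neighbour but v, the set {v, w} would be closed under adjacency and
    exhaust F, which is the case already treated.\<close>
  have branching: "\<exists>a. adj F w a \<and> a \<noteq> v" if v: "{w. adj F v w} = {w}" for v w
  proof (rule ccontr)
    assume no: "\<not> ?thesis"
    have vw: "adj F v w" using v by blast
    have "verts F \<subseteq> {v, w}"
    proof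
      fix x assume "x \<in> verts F"
      then have "(adj F)\<^sup>*\<^sup>* v x"
        using conn vw in_verts connected_graph_iff[OF simpleF] by blast
      then show "x \<in> {v, w}"
        by (rule rtranclp_closed) (use v no in blast)+
    qed
    then show False using False vw in_verts by blast
  qed
  have "\<exists>Q. maximal_clique G Q \<and> Q \<inter> verts F = closed_nbhd F v" if v: "v \<in> verts F" for v
  proof -
    obtain w where w: "adj F v w" using v vertsF by blast
    show ?thesis
    proof (cases "{w. adj F v w} = {w}")
      case True
      with branching[OF True] show ?thesis using clique_at_end by metis
    next
      case False
      with w obtain b where "adj F v b" "b \<noteq> w" by blast
      with w show ?thesis using clique_at_branching by metis
    qed
  qed
  then obtain q where q: "\<And>v. v \<in> verts F \<Longrightarrow> maximal_clique G (q v)"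
    "\<And>v. v \<in> verts F \<Longrightarrow> q v \<inter> verts F = closed_nbhd F v"
    by metis
  have "inj_on q (verts F)"
  proof (rule inj_onI, rule ccontr)
    fix v w assume vw: "v \<in> verts F" "w \<in> verts F" "q v = q w" "v \<noteq> w"
    then have N: "closed_nbhd F v = closed_nbhd F w" using q by metis
    then have "adj F v w" using vw unfolding closed_nbhd_def by auto
    \<comment> \<open>Equal closed neighbourhoods of adjacent vertices shrink to {v, w}; then v is
      an end of F, yet w cannot branch.\<close>
    with closed_nbhd_Int[OF nsc this] N have N': "closed_nbhd F v = {v, w}" by simp
    have "a = w" if "adj F v a" for a
    proof -
      have "a \<in> {v, w}" using N' that unfolding closed_nbhd_def by blast
      then show ?thesis using that irrefl by auto
    qed
    with \<open>adj F v w\<close> have "{w. adj F v w} = {w}" by blast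
    from branching[OF this] obtain a where "adj F w a" "a \<noteq> v" by blast
    then show False
      using N N' irrefl[of w] unfolding closed_nbhd_def by blast
  qed
  with q that show ?thesis by blast
qed

lemma ex_root: "\<exists>H. simple_graph H \<and> no_short_cycle H \<and> G = square H"
proof -
  obtain q where q: "\<And>v. v \<in> verts F \<Longrightarrow> maximal_clique G (q v)"
    "\<And>v. v \<in> verts F \<Longrightarrow> q v \<inter> verts F = closed_nbhd F v" "inj_on q (verts F)"
    using clique_indexing by blast
  \<comment> \<open>The star in Q contains an edge cd of F. Already \<open>q c\<close> and
    \<open>q d\<close> are two maximal cliques on this edge, so by condition (ii) Q is one of
    them.\<close>
  have surj: "\<exists>v\<in>verts F. Q = q v" if Q: "maximal_clique G Q" for Q
  proof -
    obtain c d where cd: "c \<in> Q" "d \<in> Q" "adj F c d" using clique_centre Q by blast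
    then have ver: "c \<in> verts F" "d \<in> verts F" "c \<noteq> d" using in_verts irrefl by blast+
    then have "q c \<noteq> q d" using q(3) by (auto simp: inj_on_def)
    obtain Q1 Q2
      where Q12: "Q1 \<noteq> Q2" "{Q. maximal_clique G Q \<and> c \<in> Q \<and> d \<in> Q} = {Q1, Q2}"
      using two_cliques[OF cd(3)] by blast
    have "{c, d} \<subseteq> closed_nbhd F c" "{c, d} \<subseteq> closed_nbhd F d"
      using cd(3) sym[of c d] by (auto simp: closed_nbhd_def)
    then have "{c, d} \<subseteq> q c" "{c, d} \<subseteq> q d"
      using q(2)[OF ver(1)] q(2)[OF ver(2)] by blast+
    then have "q c \<in> {Q1, Q2}" "q d \<in> {Q1, Q2}" "Q \<in> {Q1, Q2}"
      using q(1) ver cd Q unfolding Q12(2)[symmetric] by simp_all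
    with \<open>q c \<noteq> q d\<close> ver show ?thesis by auto
  qed
  \<comment> \<open>Condition (i) and injectivity of \<open>q\<close> give a vertex outside F at
    most one index, so it has degree at most one in H.\<close>
  have leaf: "v = w" if "x \<notin> verts F" "v \<in> verts F" "w \<in> verts F" "x \<in> q v" "x \<in> q w" for x v w
  proof -
    have "x \<in> verts G" using that q(1) maximal_cliqueD(1) by blast
    then have "q v = q w" using outer[of x] that q(1) by blast
    with that q(3) show ?thesis by (auto simp: inj_on_def)
  qed
  define H where "H = \<lparr>verts = verts G,
    edges = edges F \<union> {{x, v} | x v. x \<notin> verts F \<and> v \<in> verts F \<and> x \<in> q v}\<rparr>"
  have adjH: "adj H u v \<longleftrightarrow> adj F u v \<or> (u \<notin> verts F \<and> v \<in> verts F \<and> u \<in> q v)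
      \<or> (v \<notin> verts F \<and> u \<in> verts F \<and> v \<in> q u)" for u v
    unfolding H_def adj_def by (auto simp: doubleton_eq_iff)
  have qG: "q v \<subseteq> verts G" if "v \<in> verts F" for v
    using that q(1) maximal_cliqueD(1) by blast
  have simpleH: "simple_graph H"
  proof -
    have "e \<subseteq> verts G \<and> card e = 2" if "e \<in> edges F" for e
      using that simpleF verts_subset unfolding simple_graph_def by blast
    moreover have "{x, v} \<subseteq> verts G \<and> card {x, v} = 2"
      if "x \<notin> verts F" "v \<in> verts F" "x \<in> q v" for x v
      using that qG verts_subset by (auto simp: card_2_iff)
    ultimately show ?thesis
      using simple unfolding simple_graph_def H_def by auto
  qed
  have symH: "adj H b a" if "adj H a b" for a b
    using that adj_commute[of H a b] by simp
  \<comment> \<open>Inside F the two sets agree by the choice of \<open>q\<close>; outside F they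
    agree by the pendant edges. The maximal cliques of G thus become closed neighbourhoods in
    H.\<close>
  have NH: "closed_nbhd H v = q v" if "v \<in> verts F" for v
  proof -
    have "w \<in> closed_nbhd H v \<longleftrightarrow> w \<in> q v" for w
    proof (cases "w \<in> verts F")
      case True
      with that have "w \<in> closed_nbhd H v \<longleftrightarrow> w \<in> closed_nbhd F v"
        by (simp add: closed_nbhd_def adjH)
      with True q(2)[OF that] show ?thesis by blast
    next
      case False
      with that in_verts[of v w] show ?thesis by (auto simp: closed_nbhd_def adjH)
    qed
    then show ?thesis by blast
  qed
  have pendant: "a = b" if "x \<notin> verts F" "adj H x a" "adj H x b" for x a b
    using that leaf in_verts unfolding adjH by blast
  have "no_short_cycle H"
  proof -
    \<comment> \<open>Both ends of the middle edge of the path z, a, b, c have two distinct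
      neighbours, so neither is pendant; z = c is permitted, to cover triangles. Each edge of a
      cycle is such a middle edge, hence short cycles of H would lie in F.\<close>
    have inF: "adj F a b" if "adj H z a" "adj H a b" "adj H b c" "z \<noteq> b" "a \<noteq> c" for z a b c
    proof -
      have "a \<in> verts F" using pendant[of a z b] that symH by blast
      moreover have "b \<in> verts F" using pendant[of b a c] that symH by blast
      ultimately show ?thesis using that(2) adjH by blast
    qed
    have irreflH: "\<not> adj H a a" for a using adj_irrefl[OF simpleH] .
    show ?thesis
      unfolding no_short_cycle_def
    proof (intro conjI allI impI notI)
      fix a b c assume A: "adj H a b \<and> adj H b c" "adj H c a"
      then have "a \<noteq> b" "b \<noteq> c" "c \<noteq> a" using irreflH by blast+
      with A have "adj F a b" "adj F b c" "adj F c a"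
        using inF[of c a b c] inF[of a b c a] inF[of b c a b] by blast+
      then show False using triangle_free by blast
    next
      fix a b c d
      assume A: "distinct [a, b, c, d] \<and> adj H a b \<and> adj H b c \<and> adj H c d" "adj H d a"
      then have "adj F a b" "adj F b c" "adj F c d" "adj F d a"
        using inF[of d a b c] inF[of a b c d] inF[of b c d a] inF[of c d a b] by auto
      then show False using no_short_cycleD(2)[OF nsc, of a b c d] A by blast
    next
      fix a b c d e
      assume A: "distinct [a, b, c, d, e] \<and> adj H a b \<and> adj H b c \<and> adj H c d \<and> adj H d e"
        "adj H e a"
      then have "adj F a b" "adj F b c" "adj F c d" "adj F d e" "adj F e a"
        using inF[of e a b c] inF[of a b c d] inF[of b c d e] inF[of c d e a] inF[of d e a b]
        by auto
      then show False using no_short_cycleD(3)[OF nsc, of a b c d e] A by blast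
    next
      fix a b c d e f
      assume A: "distinct [a, b, c, d, e, f] \<and> adj H a b \<and> adj H b c \<and> adj H c d \<and> adj H d e
        \<and> adj H e f" "adj H f a"
      then have "adj F a b" "adj F b c" "adj F c d" "adj F d e" "adj F e f" "adj F f a"
        using inF[of f a b c] inF[of a b c d] inF[of b c d e] inF[of c d e f] inF[of d e f a]
          inF[of e f a b]
        by auto
      then show False using no_short_cycleD(4)[OF nsc, of a b c d e f] A by blast
    qed
  qed
  moreover have "G = square H"
  proof (rule ugraph_eqI[OF simple simple_graph_square[OF simpleH]])
    show "verts G = verts (square H)" by (simp add: H_def)
  next
    fix u v
    have "adj G u v \<longleftrightarrow> u \<noteq> v \<and> (\<exists>z\<in>verts F. u \<in> closed_nbhd H z \<and> v \<in> closed_nbhd H z)"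
      using adj_iff_maximal_clique[OF simple] surj q(1) NH by metis
    also have "\<dots> \<longleftrightarrow> u \<noteq> v \<and> (adj H u v \<or> (\<exists>z. adj H u z \<and> adj H z v))"
    proof (intro conj_cong refl iffI)
      assume "\<exists>z\<in>verts F. u \<in> closed_nbhd H z \<and> v \<in> closed_nbhd H z" "u \<noteq> v"
      then show "adj H u v \<or> (\<exists>z. adj H u z \<and> adj H z v)"
        using symH unfolding closed_nbhd_def by blast
    next
      assume "u \<noteq> v" and "adj H u v \<or> (\<exists>z. adj H u z \<and> adj H z v)"
      then consider "adj H u v" | z where "adj H u z" "adj H z v" by blast
      then show "\<exists>z\<in>verts F. u \<in> closed_nbhd H z \<and> v \<in> closed_nbhd H z"
      proof cases
        case 1
        \<comment> \<open>Every edge of H has an end in F, which serves as the centre z.\<close>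
        then have "u \<in> verts F \<or> v \<in> verts F" using in_verts adjH by blast
        with 1 show ?thesis using symH unfolding closed_nbhd_def by blast
      next
        case 2
        \<comment> \<open>The middle vertex z has the distinct neighbours u and v, so it is not
          pendant.\<close>
        then have "z \<in> verts F" using pendant[of z u v] \<open>u \<noteq> v\<close> symH by blast
        with 2 show ?thesis using symH unfolding closed_nbhd_def by blast
      qed
    qed
    finally show "adj G u v \<longleftrightarrow> adj (square H) u v" by (simp only: adj_square_iff[OF simpleH])
  qed
  ultimately show ?thesis using simpleH by blast
qed

end

section \<open>Squares of graphs of girth at least seven characterised by forced edges\<close>

theorem theorem2p4:
  fixes G F :: "'a ugraph"
  assumes "simple_graph G" and "connected_graph G" and "\<not> complete_graph G"
    and "F = forced_subgraph G"
  shows "(\<exists>H :: 'a ugraph. simple_graph H \<and> girth H \<ge> 7 \<and> G = square H) \<longleftrightarrow>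
    (\<forall>v\<in>verts G - verts F. \<exists>!Q. maximal_clique G Q \<and> v \<in> Q) \<and>
    (\<forall>e\<in>edges F. card {Q. maximal_clique G Q \<and> e \<subseteq> Q} = 2) \<and>
    (\<forall>e\<in>edges F. \<forall>f\<in>edges F. e \<noteq> f \<and> e \<inter> f \<noteq> {} \<longrightarrow>
       (\<exists>Q. maximal_clique G Q \<and> e \<subseteq> Q \<and> f \<subseteq> Q)) \<and>
    (\<forall>Q. maximal_clique G Q \<longrightarrow> star (induced_subgraph F (Q \<inter> verts F))) \<and>
    (connected_graph F \<and> girth F \<ge> 7)"
    (is "?root \<longleftrightarrow> ?conditions")
proof
  assume ?root
  then obtain H where H: "simple_graph H" "girth H \<ge> 7" "G = square H" by blast
  interpret large_girth_root H
  proof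
    show "simple_graph H" by fact
    show "no_short_cycle H" using girth_ge_7_iff H(1,2) by blast
    show "connected_graph (square H)" "\<not> complete_graph (square H)"
      using assms(2,3) unfolding H(3) .
  qed
  have F: "F = forced_subgraph (square H)" using assms(4) H(3) by simp
  show ?conditions
    unfolding H(3) F verts_square verts_forced
  proof (intro conjI ballI allI impI, goal_cases)
    case (1 v)
    then show ?case by (rule outer_unique_clique)
  next
    case (2 e)
    then show ?case by (rule forced_edge_two_cliques)
  next
    case (3 e f)
    then show ?case using forced_edges_common_clique[of e f] by simp
  next
    case (4 Q)
    then show ?case using star_forced by (simp add: verts_forced)
  next
    case 5
    show ?case by (rule connected_forced)
  next
    case 6
    show ?case using girth_ge_7_iff[OF simple_forced] nsc_forced by simp
  qed
next
  assume c: ?conditions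
  note c1 = c[THEN conjunct1] and c' = c[THEN conjunct2]
  note c2 = c'[THEN conjunct1] and c3 = c'[THEN conjunct2, THEN conjunct1]
    and c45 = c'[THEN conjunct2, THEN conjunct2]
  have F: "simple_graph F"
    unfolding assms(4) by (rule simple_graph_forced_subgraph[OF assms(1)])
  interpret root_conditions G F
  proof
    show "simple_graph G" "F = forced_subgraph G" by fact+
    show "\<exists>!Q. maximal_clique G Q \<and> v \<in> Q" if "v \<in> verts G - verts F" for v
      using c1 that by (rule bspec)
    show "card {Q. maximal_clique G Q \<and> e \<subseteq> Q} = 2" if "e \<in> edges F" for e
      using c2 that by (rule bspec)
    show "\<exists>Q. maximal_clique G Q \<and> e \<subseteq> Q \<and> f \<subseteq> Q"
      if "e \<in> edges F" "f \<in> edges F" "e \<noteq> f" "e \<inter> f \<noteq> {}" for e f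
      using bspec[OF bspec[OF c3 that(1)] that(2)] that(3,4) by (simp only: simp_thms)
    show "star (induced_subgraph F (Q \<inter> verts F))" if "maximal_clique G Q" for Q
      using c45 that by simp
    show "connected_graph F" "no_short_cycle F"
      using c45 girth_ge_7_iff[OF F] by simp_all
  qed
  obtain H where "simple_graph H" "no_short_cycle H" "G = square H"
    using ex_root by blast
  then show ?root using girth_ge_7_iff[of H] by (intro exI[of _ H]) simp
qed

end
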